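(* Let $\mathcal{A}=(A_1,\ldots,A_s)$ be any presentation of a transversal matroid $M$ with rank function $r$. Then $M$ is a fundamental transversal matroid if and only if $$r\Bigl(\bigcap_{F\in\mathcal{F}}F\Bigr)=\Bigl|\bigcap_{F\in\mathcal{F}}\Delta(F)\Bigr|$$ for every nonempty subset $\mathcal{F}$ of $\mathcal{Z}(M)$; equivalently, for every nonempty filter $\mathcal{F}$ of $\mathcal{Z}(M)$; equivalently, for every nonempty antichain $\mathcal{F}$ of $\mathcal{Z}(M)$.
   Context: Matroids have finite ground sets; $E(M)$ is the ground set of $M$. A set system on a set $S$ is a finite multiset $(A_1,\ldots,A_s)$ of subsets of $S$. A partial transversal of it is a subset $I\subseteq S$ for which there is an injection $\psi:I\to\{1,\ldots,s\}$ with $x\in A_{\psi(x)}$ for all $x\in I$. The partial transversals are the independent sets of a matroid on $S$; such a matroid is called transversal and the set system is a presentation of it. A fundamental transversal matroid is a transversal matroid that has a presentation $(B_1,\ldots,B_t)$ for which no difference $B_i-\bigcup_{j\ne i}B_j$, for $1\le i\le t$, is empty. (Equivalently, $M$ is a matroid having a fundamental basis, that is, a basis $B$ such that each $F\in\mathcal{Z}(M)$ is spanned by $B\cap F$.) Given the presentation $\mathcal{A}=(A_1,\ldots,A_s)$ and a simplex $\Delta$ with vertices $v_1,\ldots,v_s$ (distinct labels, one for each set of $\mathcal{A}$), for $x\in E(M)$ let $\Delta(x)=\{v_k: x\in A_k\}$, and for $X\subseteq E(M)$ let $\Delta(X)=\bigcup_{x\in X}\Delta(x)=\{v_k: X\cap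 A_k\neq\emptyset\}$. A set $X\subseteq E(M)$ is cyclic if it is a union of circuits of $M$ (the empty set is cyclic). $\mathcal{Z}(M)$ is the set of all cyclic flats of $M$, ordered by inclusion. An antichain in $\mathcal{Z}(M)$ is a subset no two of whose members are related by inclusion. A filter in $\mathcal{Z}(M)$ is a subset $\mathcal{F}\subseteq\mathcal{Z}(M)$ such that if $A\in\mathcal{F}$, $B\in\mathcal{Z}(M)$ and $A\subseteq B$, then $B\in\mathcal{F}$. *)

theory Defs
  imports Main
begin

record 'a indep_structure =
  ground :: "'a set"
  indep :: "'a set \<Rightarrow> bool"

locale matroid =
  fixes M :: "'a indep_structure"
  assumes finite_ground: "finite (ground M)"
    and indep_subset_ground: "indep M I \<Longrightarrow> I \<subseteq> ground M"
    and indep_empty: "indep M {}"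
    and indep_subset: "indep M J \<Longrightarrow> I \<subseteq> J \<Longrightarrow> indep M I"
    and indep_augment:
      "indep M I \<Longrightarrow> indep M J \<Longrightarrow> card I < card J \<Longrightarrow> \<exists>x\<in>J - I. indep M (insert x I)"

definition rank_of :: "'a indep_structure \<Rightarrow> 'a set \<Rightarrow> nat" where
  "rank_of M X = Max (card ` {I. I \<subseteq> X \<and> indep M I})"

definition closure_of_set :: "'a indep_structure \<Rightarrow> 'a set \<Rightarrow> 'a set" where
  "closure_of_set M X = {x \<in> ground M. rank_of M (insert x X) = rank_of M X}"

definition is_flat :: "'a indep_structure \<Rightarrow> 'a set \<Rightarrow> bool" where
  "is_flat M X \<longleftrightarrow> X \<subseteq> ground M \<and> closure_of_set M X = X"

definition is_circuit :: "'a indep_structure \<Rightarrow> 'a set \<Rightarrow> bool" where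
  "is_circuit M C \<longleftrightarrow> C \<subseteq> ground M \<and> \<not> indep M C \<and> (\<forall>D. D \<subset> C \<longrightarrow> indep M D)"

definition is_cyclic :: "'a indep_structure \<Rightarrow> 'a set \<Rightarrow> bool" where
  "is_cyclic M X \<longleftrightarrow> (\<exists>\<C>. (\<forall>C\<in>\<C>. is_circuit M C) \<and> X = \<Union>\<C>)"

definition cyclic_flats :: "'a indep_structure \<Rightarrow> 'a set set" where
  "cyclic_flats M = {X. is_flat M X \<and> is_cyclic M X}"

definition is_filter_in :: "'a set set \<Rightarrow> 'a set set \<Rightarrow> bool" where
  "is_filter_in \<Z> \<F> \<longleftrightarrow> \<F> \<subseteq> \<Z> \<and> (\<forall>A\<in>\<F>. \<forall>B\<in>\<Z>. A \<subseteq> B \<longrightarrow> B \<in> \<F>)"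

definition is_antichain_in :: "'a set set \<Rightarrow> 'a set set \<Rightarrow> bool" where
  "is_antichain_in \<Z> \<F> \<longleftrightarrow> \<F> \<subseteq> \<Z> \<and> (\<forall>A\<in>\<F>. \<forall>B\<in>\<F>. A \<subseteq> B \<longrightarrow> A = B)"

text \<open>
  A set system \<open>(A\<^sub>1, \<dots>, A\<^sub>s)\<close> is a list of sets, so repeated and empty members are
  allowed; its index set is \<open>{..<length \<A>}\<close>, that is, the indices are shifted by one.
\<close>

definition set_system_on :: "'a set \<Rightarrow> 'a set list \<Rightarrow> bool" where
  "set_system_on S \<A> \<longleftrightarrow> (\<forall>k<length \<A>. \<A> ! k \<subseteq> S)"

definition partial_transversal :: "'a set \<Rightarrow> 'a set list \<Rightarrow> 'a set \<Rightarrow> bool" where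
  "partial_transversal S \<A> I \<longleftrightarrow> I \<subseteq> S \<and>
     (\<exists>\<psi>. inj_on \<psi> I \<and> \<psi> ` I \<subseteq> {..<length \<A>} \<and> (\<forall>x\<in>I. x \<in> \<A> ! \<psi> x))"

definition is_presentation :: "'a indep_structure \<Rightarrow> 'a set list \<Rightarrow> bool" where
  "is_presentation M \<A> \<longleftrightarrow> set_system_on (ground M) \<A> \<and>
     (\<forall>I. indep M I \<longleftrightarrow> partial_transversal (ground M) \<A> I)"

definition transversal_matroid :: "'a indep_structure \<Rightarrow> bool" where
  "transversal_matroid M \<longleftrightarrow> matroid M \<and> (\<exists>\<A>. is_presentation M \<A>)"

definition fundamental_transversal_matroid :: "'a indep_structure \<Rightarrow> bool" where
  "fundamental_transversal_matroid M \<longleftrightarrow> transversal_matroid M \<and>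
     (\<exists>\<B>. is_presentation M \<B> \<and>
       (\<forall>i<length \<B>. \<B> ! i - (\<Union>j\<in>{..<length \<B>} - {i}. \<B> ! j) \<noteq> {}))"

text \<open>
  Only the labels of the vertices of the simplex matter: \<open>v k\<close> is the vertex
  attached to the set \<open>\<A> ! k\<close>, and \<open>v\<close> is required to be injective on the index set
  where these functions are used.
\<close>

definition Delta_elem :: "(nat \<Rightarrow> 'v) \<Rightarrow> 'a set list \<Rightarrow> 'a \<Rightarrow> 'v set" where
  "Delta_elem v \<A> x = {v k |k. k < length \<A> \<and> x \<in> \<A> ! k}"

definition Delta :: "(nat \<Rightarrow> 'v) \<Rightarrow> 'a set list \<Rightarrow> 'a set \<Rightarrow> 'v set" where
  "Delta v \<A> X = (\<Union>x\<in>X. Delta_elem v \<A> x)"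

end

theory Submission
  imports Defs
begin

text \<open>
  A cyclic set \<open>X\<close> has rank \<open>\<bar>\<Delta>(X)\<bar>\<close>. Hence a matching of a fundamental basis \<open>B\<close> maps
  \<open>B \<inter> F\<close> onto \<open>\<Delta>(F)\<close> for each cyclic flat \<open>F\<close>, and since it is injective it maps
  \<open>B \<inter> \<Inter>\<F>\<close> onto \<open>\<Inter>{\<Delta>(F) | F \<in> \<F>}\<close>, which gives the rank equation.

  Conversely, for an index \<open>k\<close> let \<open>I\<^sub>k\<close> be the intersection of the cyclic flats \<open>F\<close> with
  \<open>k \<in> \<Delta>(F)\<close>; these flats form a filter. The rank equation says \<open>r(I\<^sub>k) = \<bar>\<Delta>(I\<^sub>k)\<bar>\<close>, a property
  that is inherited by unions. Therefore bases of the \<open>I\<^sub>k\<close> can be chosen greedily to fit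
  together to an independent set that spans every cyclic flat from within, and the complements
  of the closures of \<open>B - {b}\<close> for \<open>b \<in> B\<close> are then the desired presentation.
\<close>

section \<open>Neighbour sets and matchings of a set system\<close>

text \<open>This is \<Delta>(X) before the labels are attached. Injective labels preserve
  cardinalities, so the argument runs on indices throughout.\<close>

definition nbrs :: "'a set list \<Rightarrow> 'a set \<Rightarrow> nat set" where
  "nbrs \<A> X = {k. k < length \<A> \<and> X \<inter> \<A> ! k \<noteq> {}}"

definition matching :: "'a set list \<Rightarrow> ('a \<Rightarrow> nat) \<Rightarrow> 'a set \<Rightarrow> bool" where
  "matching \<A> \<psi> I \<longleftrightarrow> inj_on \<psi> I \<and> (\<forall>x\<in>I. \<psi> x < length \<A> \<and> x \<in> \<A> ! \<psi> x)"

lemma finite_nbrs [simp]: "finite (nbrs \<A> X)"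
  by (simp add: nbrs_def)

lemma nbrs_mono: "X \<subseteq> Y \<Longrightarrow> nbrs \<A> X \<subseteq> nbrs \<A> Y"
  by (auto simp: nbrs_def)

lemma nbrs_Un: "nbrs \<A> (X \<union> Y) = nbrs \<A> X \<union> nbrs \<A> Y"
  by (auto simp: nbrs_def)

lemma Delta_eq_image_nbrs: "Delta v \<A> X = v ` nbrs \<A> X"
  by (auto simp: Delta_def Delta_elem_def nbrs_def)

lemma card_Inter_Delta:
  assumes "inj_on v {..<length \<A>}" "\<F> \<noteq> {}"
  shows "card (\<Inter>F\<in>\<F>. Delta v \<A> F) = card (\<Inter>F\<in>\<F>. nbrs \<A> F)"
proof -
  obtain G where G: "G \<in> \<F>" using assms(2) by blast
  have sub: "nbrs \<A> F \<subseteq> {..<length \<A>}" for F by (auto simp: nbrs_def)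
  have eq: "(\<Inter>F\<in>\<F>. Delta v \<A> F) = v ` (\<Inter>F\<in>\<F>. nbrs \<A> F)"
    using image_INT[OF assms(1), of \<F> "nbrs \<A>" G] sub G by (simp add: Delta_eq_image_nbrs)
  have "inj_on v (\<Inter>F\<in>\<F>. nbrs \<A> F)"
    by (rule inj_on_subset[OF assms(1)]) (use G sub in blast)
  then show ?thesis by (simp add: eq card_image)
qed

lemma matching_subset: "matching \<A> \<psi> J \<Longrightarrow> I \<subseteq> J \<Longrightarrow> matching \<A> \<psi> I"
  by (auto simp: matching_def intro: inj_on_subset)

lemma matching_image_nbrs: "matching \<A> \<psi> I \<Longrightarrow> I \<subseteq> X \<Longrightarrow> \<psi> ` I \<subseteq> nbrs \<A> X"
  by (auto simp: matching_def nbrs_def)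

lemma matching_card_le:
  assumes "matching \<A> \<psi> I" "I \<subseteq> X"
  shows "card I \<le> card (nbrs \<A> X)"
  using assms card_mono[OF finite_nbrs matching_image_nbrs[OF assms]]
  by (simp add: matching_def card_image)

lemma matching_disjoint_Un:
  assumes "matching \<A> \<phi> I" "matching \<A> \<psi> J" "\<phi> ` I \<inter> \<psi> ` J = {}"
  shows "matching \<A> (\<lambda>x. if x \<in> I then \<phi> x else \<psi> x) (I \<union> J)"
  using assms inj_on_disjoint_Un[of \<phi> I \<psi> J] by (auto simp: matching_def)

section \<open>Hall's marriage theorem\<close>

text \<open>Either every nonempty proper subset has a neighbour to spare, so that one element may
  use up any value, or some proper subset has just as many neighbours as elements and is matched
  separately from the rest.\<close>

lemma hall_marriage:
  assumes "finite I" "\<And>x. x \<in> I \<Longrightarrow> finite (D x)"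
    and "\<And>Y. Y \<subseteq> I \<Longrightarrow> card Y \<le> card (\<Union>x\<in>Y. D x)"
  shows "\<exists>g. inj_on g I \<and> (\<forall>x\<in>I. g x \<in> D x)"
  using assms
proof (induction I arbitrary: D rule: finite_psubset_induct)
  case (psubset I D)
  note fin = psubset.hyps psubset.prems(1)
  have finU: "finite (\<Union>x\<in>Y. D x)" if "Y \<subseteq> I" for Y
    using that fin finite_subset[OF that] by blast
  consider "I = {}"
    | x where "x \<in> I" "\<And>Y. Y \<subset> I \<Longrightarrow> Y \<noteq> {} \<Longrightarrow> card Y < card (\<Union>x\<in>Y. D x)"
    | Y where "Y \<subset> I" "Y \<noteq> {}" "card (\<Union>x\<in>Y. D x) \<le> card Y"
    by (meson all_not_in_conv not_less)
  then show ?case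
  proof cases
    case 1
    then show ?thesis by simp
  next
    case (2 x)
    have "D x \<noteq> {}" using psubset.prems(2)[of "{x}"] 2(1) by auto
    then obtain b where b: "b \<in> D x" by blast
    have "\<exists>g. inj_on g (I - {x}) \<and> (\<forall>y\<in>I - {x}. g y \<in> D y - {b})"
    proof (rule psubset.IH)
      fix Y assume Y: "Y \<subseteq> I - {x}"
      have eq: "(\<Union>y\<in>Y. D y - {b}) = (\<Union>y\<in>Y. D y) - {b}" by blast
      show "card Y \<le> card (\<Union>y\<in>Y. D y - {b})"
      proof (cases "Y = {}")
        case False
        then have "card Y < card (\<Union>y\<in>Y. D y)" using 2 Y by blast
        then show ?thesis unfolding eq using diff_card_le_card_Diff[of "{b}" "\<Union>y\<in>Y. D y"] by simp
      qed simp
    qed (use 2(1) fin in auto)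
    then obtain g where g: "inj_on g (I - {x})" "\<forall>y\<in>I - {x}. g y \<in> D y - {b}" by blast
    then have "inj_on (g(x := b)) I"
      unfolding inj_on_def by (metis Diff_iff fun_upd_apply singletonD singletonI)
    moreover have "\<forall>y\<in>I. (g(x := b)) y \<in> D y" using g(2) b by simp
    ultimately show ?thesis by blast
  next
    case (3 Y)
    define T where "T = (\<Union>x\<in>Y. D x)"
    have YI: "Y \<subseteq> I" using 3(1) by blast
    have "\<exists>g. inj_on g Y \<and> (\<forall>x\<in>Y. g x \<in> D x)"
      by (rule psubset.IH[OF 3(1)]) (use YI psubset.prems in blast)+
    then obtain g where g: "inj_on g Y" "\<forall>x\<in>Y. g x \<in> D x" by blast
    have "\<exists>h. inj_on h (I - Y) \<and> (\<forall>x\<in>I - Y. h x \<in> D x - T)"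
    proof (rule psubset.IH)
      fix Z assume Z: "Z \<subseteq> I - Y"
      have finZ: "finite Z" "finite Y" using Z YI fin(1) finite_subset by blast+
      \<comment> \<open>Hall's condition for \<open>Z \<union> Y\<close>, minus the at most
        \<open>card Y\<close> values in \<open>T\<close>, is Hall's condition for \<open>Z\<close>
        outside \<open>T\<close>.\<close>
      have "card Z + card Y = card (Z \<union> Y)"
        by (rule card_Un_disjoint[symmetric]) (use finZ Z in auto)
      also have "\<dots> \<le> card (\<Union>x\<in>Z \<union> Y. D x)"
        by (rule psubset.prems(2)) (use Z YI in auto)
      also have "(\<Union>x\<in>Z \<union> Y. D x) = (\<Union>x\<in>Z. D x - T) \<union> T" unfolding T_def by blast
      also have "card \<dots> \<le> card (\<Union>x\<in>Z. D x - T) + card T" by (rule card_Un_le)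
      finally show "card Z \<le> card (\<Union>x\<in>Z. D x - T)" using 3(3) unfolding T_def by linarith
    qed (use 3 fin in auto)
    then obtain h where h: "inj_on h (I - Y)" "\<forall>x\<in>I - Y. h x \<in> D x - T" by blast
    have "g ` Y \<subseteq> T" using g(2) by (auto simp: T_def)
    moreover have "h ` (I - Y) \<inter> T = {}" using h(2) by auto
    ultimately have "g ` Y \<inter> h ` (I - Y) = {}" by blast
    from inj_on_disjoint_Un[OF g(1) h(1) this] YI
    have "inj_on (\<lambda>x. if x \<in> Y then g x else h x) I" by (simp add: Un_absorb1)
    moreover have "\<forall>x\<in>I. (if x \<in> Y then g x else h x) \<in> D x" using g(2) h(2) by simp
    ultimately show ?thesis by (intro exI[of _ "\<lambda>x. if x \<in> Y then g x else h x"]) blast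
  qed
qed

text \<open>
  The spanning condition is stated as an inequality of ranks, and \<open>B\<close> is only required to
  be independent: every basis containing \<open>B\<close> has the same property.
\<close>

definition fundamental_basis :: "'a indep_structure \<Rightarrow> 'a set \<Rightarrow> bool" where
  "fundamental_basis M B \<longleftrightarrow>
    indep M B \<and> (\<forall>F\<in>cyclic_flats M. rank_of M F \<le> card (B \<inter> F))"

context matroid
begin

section \<open>Rank, closure and circuits\<close>

lemma indep_finite: "indep M I \<Longrightarrow> finite I"
  using finite_ground indep_subset_ground finite_subset by blast

lemma finite_indep_subsets: "finite {I. I \<subseteq> X \<and> indep M I}"
  by (rule finite_subset[of _ "Pow (ground M)"]) (use finite_ground indep_subset_ground in auto)

lemma card_le_rank: "indep M I \<Longrightarrow> I \<subseteq> X \<Longrightarrow> card I \<le> rank_of M X"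
  unfolding rank_of_def using finite_indep_subsets[of X] by (intro Max_ge) auto

lemma basis_extension:
  assumes "indep M I" "I \<subseteq> X"
  shows "\<exists>J. I \<subseteq> J \<and> J \<subseteq> X \<and> indep M J \<and> card J = rank_of M X"
  using assms
proof (induction "rank_of M X - card I" arbitrary: I rule: less_induct)
  case less
  have "rank_of M X \<in> card ` {I. I \<subseteq> X \<and> indep M I}"
    unfolding rank_of_def using finite_indep_subsets[of X] indep_empty
    by (intro Max_in) auto
  then obtain K where K: "K \<subseteq> X" "indep M K" "card K = rank_of M X" by auto
  show ?case
  proof (cases "card I = rank_of M X")
    case False
    with card_le_rank[OF less.prems] have lt: "card I < card K" unfolding K(3) by simp
    from indep_augment[OF less.prems(1) K(2) lt] obtain x
      where x: "x \<in> K - I" "indep M (insert x I)" by blast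
    have "card (insert x I) = Suc (card I)" using x indep_finite[OF less.prems(1)] by simp
    then have "rank_of M X - card (insert x I) < rank_of M X - card I"
      using lt unfolding K(3) by simp
    moreover have "insert x I \<subseteq> X" using x K(1) less.prems(2) by blast
    ultimately have "\<exists>J. insert x I \<subseteq> J \<and> J \<subseteq> X \<and> indep M J \<and> card J = rank_of M X"
      by (rule less.hyps[OF _ x(2)])
    then show ?thesis by blast
  qed (use less.prems in blast)
qed

lemma rank_eq_card_maximal:
  assumes "indep M J" "J \<subseteq> X" "\<And>x. x \<in> X - J \<Longrightarrow> \<not> indep M (insert x J)"
  shows "rank_of M X = card J"
proof -
  obtain K where K: "J \<subseteq> K" "K \<subseteq> X" "indep M K" "card K = rank_of M X"
    using basis_extension[OF assms(1,2)] by blast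
  have "K = J"
  proof (rule ccontr)
    assume "K \<noteq> J"
    then obtain x where "x \<in> K - J" using K by blast
    then show False using assms(3) K indep_subset[of K "insert x J"] by blast
  qed
  with K show ?thesis by simp
qed

lemma rank_mono: "X \<subseteq> Y \<Longrightarrow> rank_of M X \<le> rank_of M Y"
  using basis_extension[OF indep_empty, of X] card_le_rank by fastforce

lemma subset_closure: "X \<subseteq> ground M \<Longrightarrow> X \<subseteq> closure_of_set M X"
  by (auto simp: closure_of_set_def insert_absorb)

text \<open>Otherwise \<open>insert x J\<close> would exceed the rank of \<open>insert x X\<close>,
  which equals that of \<open>X\<close>. So a basis of \<open>X\<close> stays maximal in the
  closure.\<close>

lemma closure_not_indep_insert:
  assumes "indep M J" "J \<subseteq> X" "card J = rank_of M X" "x \<in> closure_of_set M X" "x \<notin> J"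
  shows "\<not> indep M (insert x J)"
proof
  assume "indep M (insert x J)"
  from card_le_rank[OF this, of "insert x X"] assms indep_finite[OF assms(1)]
  show False by (auto simp: closure_of_set_def)
qed

lemma rank_closure:
  assumes "X \<subseteq> ground M"
  shows "rank_of M (closure_of_set M X) = rank_of M X"
proof -
  obtain J where J: "J \<subseteq> X" "indep M J" "card J = rank_of M X"
    using basis_extension[OF indep_empty, of X] by blast
  show ?thesis
    using rank_eq_card_maximal[OF J(2), of "closure_of_set M X"]
      closure_not_indep_insert[OF J(2,1,3)] J subset_closure[OF assms] by auto
qed

lemma flat_closure:
  assumes "X \<subseteq> ground M"
  shows "is_flat M (closure_of_set M X)"
proof -
  let ?c = "closure_of_set M X"
  have c: "?c \<subseteq> ground M" by (auto simp: closure_of_set_def)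
  have "x \<in> ?c" if "x \<in> closure_of_set M ?c" for x
  proof -
    have x: "x \<in> ground M" "rank_of M (insert x ?c) = rank_of M X"
      using that rank_closure[OF assms] by (auto simp: closure_of_set_def)
    have "rank_of M (insert x X) \<le> rank_of M X"
      using rank_mono[of "insert x X" "insert x ?c"] subset_closure[OF assms] x by auto
    then have "rank_of M (insert x X) = rank_of M X"
      using rank_mono[OF subset_insertI, of X x] by simp
    with x show ?thesis by (simp add: closure_of_set_def)
  qed
  with subset_closure[OF c] c show ?thesis by (auto simp: is_flat_def)
qed

lemma dependent_contains_circuit:
  assumes "X \<subseteq> ground M" "\<not> indep M X"
  shows "\<exists>C\<subseteq>X. is_circuit M C"
proof -
  have "finite X" using assms finite_ground finite_subset by blast
  then show ?thesis using assms
  proof (induction X rule: finite_psubset_induct)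
    case (psubset X)
    show ?case
    proof (cases "is_circuit M X")
      case False
      then obtain D where "D \<subset> X" "\<not> indep M D"
        using psubset.prems by (auto simp: is_circuit_def)
      moreover from this obtain C where "C \<subseteq> D" "is_circuit M C"
        using psubset.IH[of D] psubset.prems by blast
      ultimately show ?thesis by blast
    qed auto
  qed
qed

lemma circuit_minus_indep:
  assumes "is_circuit M C" "c \<in> C"
  shows "indep M (C - {c})"
  using assms unfolding is_circuit_def by blast

lemma rank_circuit:
  assumes "is_circuit M C"
  shows "card C = Suc (rank_of M C)"
proof -
  have "C \<noteq> {}" using assms indep_empty by (auto simp: is_circuit_def)
  then obtain c where c: "c \<in> C" by blast
  have "finite C" using assms finite_ground finite_subset by (auto simp: is_circuit_def)
  moreover have "rank_of M C = card (C - {c})"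
  proof (rule rank_eq_card_maximal[OF circuit_minus_indep[OF assms c]])
    fix x assume "x \<in> C - (C - {c})"
    then have "insert x (C - {c}) = C" using c by blast
    then show "\<not> indep M (insert x (C - {c}))" using assms by (simp add: is_circuit_def)
  qed auto
  ultimately show ?thesis using c card_gt_0_iff[of C] by auto
qed

text \<open>A closure element outside \<open>C\<close> depends on a basis of \<open>C\<close>, and a
  circuit witnessing this passes through it and stays in the closure. Conditions on cyclic flats
  thus reach circuits.\<close>

lemma closure_circuit_cyclic_flat:
  assumes "is_circuit M C"
  shows "closure_of_set M C \<in> cyclic_flats M"
proof -
  let ?F = "closure_of_set M C"
  have CE: "C \<subseteq> ground M" using assms by (simp add: is_circuit_def)
  note CF = subset_closure[OF CE]
  have ex: "\<exists>D\<subseteq>?F. is_circuit M D \<and> x \<in> D" if "x \<in> ?F" for x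
  proof (cases "x \<in> C")
    case False
    obtain J where J: "J \<subseteq> C" "indep M J" "card J = rank_of M C"
      using basis_extension[OF indep_empty, of C] by blast
    have "\<not> indep M (insert x J)"
      using closure_not_indep_insert[OF J(2,1,3) that] False J by blast
    moreover have "insert x J \<subseteq> ground M"
      using that J CE by (auto simp: closure_of_set_def)
    ultimately obtain D where D: "D \<subseteq> insert x J" "is_circuit M D"
      using dependent_contains_circuit by blast
    have "x \<in> D"
      using D J(2) indep_subset[of J D] by (auto simp: is_circuit_def)
    then show ?thesis using D J CF that by blast
  qed (use CF assms in blast)
  have "is_cyclic M ?F"
    unfolding is_cyclic_def
    by (rule exI[of _ "{D. D \<subseteq> ?F \<and> is_circuit M D}"]) (use ex in blast)
  with flat_closure[OF CE] show ?thesis by (simp add: cyclic_flats_def)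
qed

lemma finite_cyclic_flats: "finite (cyclic_flats M)"
  by (rule finite_subset[of _ "Pow (ground M)"])
    (use finite_ground in \<open>auto simp: cyclic_flats_def is_flat_def\<close>)

section \<open>Greedy construction of an independent set along a preorder\<close>

text \<open>
  The set is extended along the preorder \<open>l \<in> up k\<close> by one equivalence class \<open>cls\<close> of
  minimal elements at a time. The new elements lie in the sets of this class because the
  old ones already span the sets of all other classes.
\<close>

lemma indep_meeting_up_sets:
  assumes finV: "finite V"
    and refl: "\<And>k. k \<in> V \<Longrightarrow> k \<in> up k"
    and sub: "\<And>k. k \<in> V \<Longrightarrow> up k \<subseteq> V"
    and trans: "\<And>k l. k \<in> V \<Longrightarrow> l \<in> up k \<Longrightarrow> up l \<subseteq> up k"
    and rank: "\<And>W. W \<subseteq> V \<Longrightarrow> \<forall>k\<in>W. up k \<subseteq> W \<Longrightarrow> rank_of M (\<Union>k\<in>W. f k) = card W"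
    and U: "U \<subseteq> V" "\<forall>k\<in>U. up k \<subseteq> U"
  shows "\<exists>B. indep M B \<and> B \<subseteq> (\<Union>k\<in>U. f k) \<and>
    (\<forall>W\<subseteq>U. (\<forall>k\<in>W. up k \<subseteq> W) \<longrightarrow> card W \<le> card (B \<inter> (\<Union>k\<in>W. f k)))"
  using finite_subset[OF U(1) finV] U
proof (induction U rule: finite_psubset_induct)
  case (psubset U)
  show ?case
  proof (cases "U = {}")
    case True
    then show ?thesis using indep_empty by auto
  next
    case False
    \<comment> \<open>Where \<open>up k\<close> is largest, \<open>k\<close> is minimal:
      \<open>k \<in> up l\<close> gives \<open>up k \<subseteq> up l\<close> and hence
      equality.\<close>
    have "Max ((\<lambda>k. card (up k)) ` U) \<in> (\<lambda>k. card (up k)) ` U"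
      using psubset.hyps False by (intro Max_in) auto
    then obtain k where k: "k \<in> U" and "card (up k) = Max ((\<lambda>k. card (up k)) ` U)"
      by force
    then have max: "card (up l) \<le> card (up k)" if "l \<in> U" for l
      using that psubset.hyps by simp
    define cls where "cls = {l \<in> U. k \<in> up l}"
    have kV: "k \<in> V" and UV: "U \<subseteq> V" using k psubset.prems by auto
    have cls_up: "cls \<subseteq> up k"
    proof
      fix l assume l: "l \<in> cls"
      then have lU: "l \<in> U" "k \<in> up l" by (auto simp: cls_def)
      have "up k = up l"
      proof (rule card_seteq)
        show "finite (up l)" using sub[of l] lU UV finV finite_subset by blast
        show "up k \<subseteq> up l" using trans[of l k] lU UV by blast
      qed (rule max[OF lU(1)])
      with refl[of l] lU UV show "l \<in> up k" by blast
    qed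
    \<comment> \<open>If \<open>m \<in> up l\<close> were in \<open>cls\<close>, then
      \<open>k \<in> up m \<subseteq> up l\<close> would put \<open>l\<close> into
      \<open>cls\<close> as well.\<close>
    have minus: "\<forall>l\<in>W - cls. up l \<subseteq> W - cls" if W: "W \<subseteq> U" "\<forall>l\<in>W. up l \<subseteq> W" for W
    proof (intro ballI subsetI)
      fix l m assume lm: "l \<in> W - cls" "m \<in> up l"
      then have lV: "l \<in> V" using W(1) UV by blast
      have "m \<notin> cls"
        using trans[OF lV lm(2)] lm(1) W(1) by (auto simp: cls_def)
      with lm W(2) show "m \<in> W - cls" by blast
    qed
    let ?U' = "U - cls"
    have U': "?U' \<subset> U" using k refl[OF kV] by (auto simp: cls_def)
    note clU' = minus[OF subset_refl psubset.prems(2)]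
    obtain B' where B': "indep M B'" "B' \<subseteq> (\<Union>k\<in>?U'. f k)"
      "\<And>W. W \<subseteq> ?U' \<Longrightarrow> \<forall>k\<in>W. up k \<subseteq> W \<Longrightarrow> card W \<le> card (B' \<inter> (\<Union>k\<in>W. f k))"
      using psubset.IH[OF U' _ clU'] UV by blast
    obtain B where B: "B' \<subseteq> B" "B \<subseteq> (\<Union>k\<in>U. f k)" "indep M B"
      "card B = rank_of M (\<Union>k\<in>U. f k)"
      using basis_extension[OF B'(1), of "\<Union>k\<in>U. f k"] B'(2) by blast
    have finB: "finite B" "finite B'" using B(3) B'(1) indep_finite by auto
    have cB: "card B = card U" using B(4) rank[OF psubset.prems] by simp
    have rU': "rank_of M (\<Union>k\<in>?U'. f k) = card ?U'"
      by (rule rank[OF _ clU']) (use UV in blast)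
    have cB': "card B' = card ?U'"
      using B'(3)[OF subset_refl clU'] card_le_rank[OF B'(1,2)] rU' B'(2)
      by (simp add: Int_absorb2)
    \<comment> \<open>\<open>B'\<close> already has as many elements as the rank of the union over
      \<open>?U'\<close> allows, so no new element lies in that union.\<close>
    have new: "B - B' \<subseteq> (\<Union>k\<in>cls. f k)"
    proof
      fix x assume x: "x \<in> B - B'"
      have "x \<notin> (\<Union>k\<in>?U'. f k)"
      proof
        assume "x \<in> (\<Union>k\<in>?U'. f k)"
        moreover have "indep M (insert x B')"
          by (rule indep_subset[OF B(3)]) (use x B(1) in blast)
        ultimately have "card (insert x B') \<le> card ?U'"
          using card_le_rank[of "insert x B'" "\<Union>k\<in>?U'. f k"] B'(2) rU' by simp
        then show False using x finB cB' by simp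
      qed
      then show "x \<in> (\<Union>k\<in>cls. f k)" using x B(2) by blast
    qed
    have "card W \<le> card (B \<inter> (\<Union>k\<in>W. f k))" if W: "W \<subseteq> U" "\<forall>k\<in>W. up k \<subseteq> W" for W
    proof (cases "W \<inter> cls = {}")
      case True
      then have "card W \<le> card (B' \<inter> (\<Union>k\<in>W. f k))" using B'(3)[OF _ W(2)] W(1) by blast
      also have "\<dots> \<le> card (B \<inter> (\<Union>k\<in>W. f k))"
        by (rule card_mono) (use finB B(1) in auto)
      finally show ?thesis .
    next
      case False
      \<comment> \<open>A set closed under \<open>up\<close> that meets \<open>cls\<close> contains
        \<open>k\<close> and hence all of \<open>cls\<close>. The count splits into old elements for
        \<open>W - cls\<close> and \<open>card cls\<close> new ones.\<close>
      then have "k \<in> W" using W(2) by (auto simp: cls_def)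
      then have clsW: "cls \<subseteq> W" using cls_up W(2) by blast
      have fin: "finite W" "finite cls" "finite U"
        using finite_subset[OF W(1) psubset.hyps] finite_subset[OF clsW] psubset.hyps by simp_all
      have "card (B - B') = card cls"
        using card_Diff_subset[OF finB(2) B(1)] cB cB' card_Diff_subset[OF fin(2), of U]
          card_mono[OF fin(3), of cls] clsW W(1) by simp
      moreover have "card (W - cls) \<le> card (B' \<inter> (\<Union>k\<in>W - cls. f k))"
        by (rule B'(3)[OF _ minus[OF W]]) (use W(1) in blast)
      moreover have "card W = card (W - cls) + card cls"
        using card_Diff_subset[OF fin(2) clsW] card_mono[OF fin(1) clsW] by simp
      moreover have "card (B' \<inter> (\<Union>k\<in>W - cls. f k)) + card (B - B')
          = card ((B' \<inter> (\<Union>k\<in>W - cls. f k)) \<union> (B - B'))"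
        by (rule card_Un_disjoint[symmetric]) (use finB in auto)
      moreover have "\<dots> \<le> card (B \<inter> (\<Union>k\<in>W. f k))"
        by (rule card_mono) (use finB B(1) new clsW in \<open>simp, blast\<close>)
      ultimately show ?thesis by linarith
    qed
    with B(2,3) show ?thesis by blast
  qed
qed

section \<open>From a fundamental basis to a presentation with private elements\<close>

text \<open>
  The presenting set attached to \<open>b \<in> B\<close> is the complement of the closure of
  \<open>B - {b}\<close>. Hall's theorem matches the independent sets; a circuit \<open>C\<close> cannot be
  matched because only the fewer than \<open>card C\<close> elements of \<open>B\<close> in its closure are available.
\<close>

lemma fundamental_transversal_if_fundamental_basis:
  assumes "fundamental_basis M B0"
  shows "fundamental_transversal_matroid M"
proof -
  have B0: "indep M B0" "\<And>F. F \<in> cyclic_flats M \<Longrightarrow> rank_of M F \<le> card (B0 \<inter> F)"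
    using assms by (auto simp: fundamental_basis_def)
  \<comment> \<open>The exchange argument below works with a basis; enlarging \<open>B0\<close> only
    enlarges the sets \<open>B0 \<inter> F\<close>.\<close>
  obtain B where B: "B0 \<subseteq> B" "B \<subseteq> ground M" "indep M B" "card B = rank_of M (ground M)"
    using basis_extension[OF B0(1) indep_subset_ground[OF B0(1)]] by blast
  have finB: "finite B" using indep_finite[OF B(3)] .
  have fund: "rank_of M F \<le> card (B \<inter> F)" if "F \<in> cyclic_flats M" for F
    using B0(2)[OF that] card_mono[of "B \<inter> F" "B0 \<inter> F"] B(1) finB by fastforce
  \<comment> \<open>For \<open>b \<in> B\<close> this is the fundamental cocircuit of
    \<open>b\<close>. The rest of \<open>B\<close> is excluded explicitly, since inserting such an
    element leaves \<open>B - {b}\<close> unchanged and independent.\<close>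
  define D where "D b = {x \<in> ground M - (B - {b}). indep M (insert x (B - {b}))}" for b
  have self: "b \<in> D b" if "b \<in> B" for b
    using that B by (auto simp: D_def insert_absorb)
  have priv: "b \<notin> D c" if "b \<in> B" "c \<noteq> b" for b c
    using that by (auto simp: D_def)
  have sdr: "\<exists>g. inj_on g I \<and> (\<forall>x\<in>I. g x \<in> {b \<in> B. x \<in> D b})" if I: "indep M I" for I
  proof (rule hall_marriage[OF indep_finite[OF I]])
    fix Y assume Y: "Y \<subseteq> I"
    define N where "N = (\<Union>x\<in>Y. {b \<in> B. x \<in> D b})"
    have NB: "N \<subseteq> B" by (auto simp: N_def)
    have "card Y \<le> card N"
    proof (rule ccontr)
      assume "\<not> card Y \<le> card N"
      \<comment> \<open>If Hall's condition fails, some \<open>x \<in> Y\<close> can be added to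
        \<open>N\<close>. Exchanging \<open>x\<close> into \<open>B\<close> while keeping
        \<open>N\<close> drops some \<open>b \<notin> N\<close>, yet then \<open>x \<in> D b\<close>
        puts \<open>b\<close> into \<open>N\<close>.\<close>
      with indep_augment[OF indep_subset[OF B(3) NB] indep_subset[OF I Y]]
      obtain x where x: "x \<in> Y - N" "indep M (insert x N)" by auto
      have xB: "x \<notin> B" using x(1) self by (auto simp: N_def)
      have xE: "x \<in> ground M" using x(1) Y I indep_subset_ground by blast
      obtain J where J: "insert x N \<subseteq> J" "J \<subseteq> insert x B" "indep M J"
        "card J = rank_of M (insert x B)"
        using basis_extension[OF x(2), of "insert x B"] NB by blast
      have cJ: "card J = card B"
        using J(4) B(4) card_le_rank[OF B(3) subset_insertI, of x]
          rank_mono[of "insert x B" "ground M"] B(2) xE by simp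
      have "\<not> B \<subseteq> J"
      proof
        assume "B \<subseteq> J"
        then have "card (insert x B) \<le> card J"
          using J(1) indep_finite[OF J(3)] by (intro card_mono) auto
        with cJ xB finB show False by simp
      qed
      then obtain b where b: "b \<in> B" "b \<notin> J" by blast
      have "insert x (B - {b}) = J"
      proof (rule card_seteq[symmetric])
        show "J \<subseteq> insert x (B - {b})" using J(2) b(2) by blast
        show "card (insert x (B - {b})) \<le> card J"
          using cJ xB finB b(1) card_Suc_Diff1[OF finB b(1)] by simp
      qed (use finB in simp)
      then have "x \<in> D b" using J(3) xE xB by (simp add: D_def)
      then have "b \<in> N" using x(1) b(1) by (auto simp: N_def)
      with J(1) b(2) show False by blast
    qed
    then show "card Y \<le> card (\<Union>x\<in>Y. {b \<in> B. x \<in> D b})" by (simp add: N_def)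
  qed (use finB in simp)
  have indep_if_sdr: "indep M I"
    if I: "I \<subseteq> ground M" "inj_on g I" "\<And>x. x \<in> I \<Longrightarrow> g x \<in> B \<and> x \<in> D (g x)" for I g
  proof (rule ccontr)
    assume "\<not> indep M I"
    then obtain C where C: "C \<subseteq> I" "is_circuit M C"
      using dependent_contains_circuit[OF I(1)] by blast
    define F where "F = closure_of_set M C"
    have F: "F \<in> cyclic_flats M" "C \<subseteq> F" "rank_of M F = rank_of M C"
      using closure_circuit_cyclic_flat[OF C(2)] subset_closure[of C] rank_closure[of C] C(2)
      by (auto simp: F_def is_circuit_def)
    \<comment> \<open>If \<open>g x\<close> were outside \<open>F\<close>, adding \<open>x\<close>
      to \<open>B \<inter> F\<close> would keep it independent and give more than
      \<open>rank_of M F\<close> elements inside \<open>F\<close>.\<close>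
    have "g ` C \<subseteq> B \<inter> F"
    proof (rule image_subsetI, rule ccontr)
      fix x assume x: "x \<in> C" "g x \<notin> B \<inter> F"
      then have "g x \<in> B" "x \<in> D (g x)" using I(3) C(1) by auto
      with x have sub: "B \<inter> F \<subseteq> B - {g x}" and xD: "x \<notin> B - {g x}" "indep M (insert x (B - {g x}))"
        by (auto simp: D_def)
      have "indep M (insert x (B \<inter> F))"
        by (rule indep_subset[OF xD(2)]) (use sub in blast)
      from card_le_rank[OF this, of F] have "card (insert x (B \<inter> F)) \<le> rank_of M F"
        using x(1) F(2) by blast
      moreover have "x \<notin> B \<inter> F" using sub xD(1) by blast
      ultimately show False using fund[OF F(1)] finB by simp
    qed
    then have "card C \<le> card (B \<inter> F)"
      using card_inj_on_le[OF inj_on_subset[OF I(2) C(1)]] finB by blast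
    also have "\<dots> \<le> rank_of M F"
      by (rule card_le_rank[OF indep_subset[OF B(3)]]) auto
    finally show False using rank_circuit[OF C(2)] F(3) by simp
  qed
  obtain bs where bs: "set bs = B" "distinct bs"
    using finite_distinct_list[OF finB] by blast
  let ?\<B> = "map D bs"
  have pres: "is_presentation M ?\<B>"
    unfolding is_presentation_def
  proof (intro conjI allI iffI)
    show "set_system_on (ground M) ?\<B>"
      by (auto simp: set_system_on_def D_def)
  next
    fix I assume I: "indep M I"
    from sdr[OF I] obtain g where g: "inj_on g I" "\<And>x. x \<in> I \<Longrightarrow> g x \<in> B \<and> x \<in> D (g x)" by blast
    have "\<forall>b. \<exists>i. b \<in> B \<longrightarrow> i < length bs \<and> bs ! i = b"
      using bs(1) by (metis in_set_conv_nth)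
    then obtain idx where idx: "\<And>b. b \<in> B \<Longrightarrow> idx b < length bs \<and> bs ! idx b = b" by metis
    have "inj_on (idx \<circ> g) I"
      using g idx unfolding inj_on_def comp_def by metis
    moreover have "(idx \<circ> g) ` I \<subseteq> {..<length ?\<B>}" "\<forall>x\<in>I. x \<in> ?\<B> ! (idx \<circ> g) x"
      using g(2) idx by auto
    ultimately show "partial_transversal (ground M) ?\<B> I"
      using indep_subset_ground[OF I] unfolding partial_transversal_def by blast
  next
    fix I assume "partial_transversal (ground M) ?\<B> I"
    then obtain \<psi> where I: "I \<subseteq> ground M" and \<psi>: "inj_on \<psi> I" "\<psi> ` I \<subseteq> {..<length bs}"
      "\<forall>x\<in>I. x \<in> ?\<B> ! \<psi> x"
      by (auto simp: partial_transversal_def)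
    show "indep M I"
    proof (rule indep_if_sdr[OF I, of "\<lambda>x. bs ! \<psi> x"])
      show "inj_on (\<lambda>x. bs ! \<psi> x) I"
        using \<psi>(1,2) nth_eq_iff_index_eq[OF bs(2)] by (auto simp: inj_on_def image_subset_iff)
      show "bs ! \<psi> x \<in> B \<and> x \<in> D (bs ! \<psi> x)" if "x \<in> I" for x
        using \<psi>(2,3) that bs(1) by (auto simp: image_subset_iff)
    qed
  qed
  have "?\<B> ! i - (\<Union>j\<in>{..<length ?\<B>} - {i}. ?\<B> ! j) \<noteq> {}" if i: "i < length ?\<B>" for i
  proof -
    have iB: "bs ! i \<in> B" using i bs(1) by auto
    have "bs ! i \<notin> ?\<B> ! j" if "j \<in> {..<length ?\<B>} - {i}" for j
      using priv[OF iB, of "bs ! j"] that i nth_eq_iff_index_eq[OF bs(2)] by auto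
    moreover have "bs ! i \<in> ?\<B> ! i" using self[OF iB] i by simp
    ultimately show ?thesis by blast
  qed
  with pres matroid_axioms show ?thesis
    unfolding fundamental_transversal_matroid_def transversal_matroid_def by blast
qed

end

section \<open>Tight sets: rank equal to the number of neighbours\<close>

locale presented_matroid = matroid +
  fixes \<A> :: "'a set list"
  assumes presentation: "is_presentation M \<A>"
begin

lemma indep_iff_matching: "indep M I \<longleftrightarrow> (\<exists>\<psi>. matching \<A> \<psi> I)"
proof -
  have "I \<subseteq> ground M" if "matching \<A> \<psi> I" for \<psi>
    using that presentation
    by (auto simp: matching_def is_presentation_def set_system_on_def)
  then have "partial_transversal (ground M) \<A> I \<longleftrightarrow> (\<exists>\<psi>. matching \<A> \<psi> I)"
    unfolding partial_transversal_def matching_def image_subset_iff lessThan_iff by blast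
  with presentation show ?thesis by (simp add: is_presentation_def)
qed

lemma rank_le_nbrs: "rank_of M X \<le> card (nbrs \<A> X)"
proof -
  obtain J where J: "J \<subseteq> X" "indep M J" "card J = rank_of M X"
    using basis_extension[OF indep_empty, of X] by blast
  then obtain \<psi> where "matching \<A> \<psi> J" using indep_iff_matching by blast
  from matching_card_le[OF this J(1)] J(3) show ?thesis by simp
qed

text \<open>
  A matching of part of \<open>X\<close> onto its neighbours and one for \<open>Y\<close> can be merged, since no
  element of \<open>X\<close> is matched to an index outside \<open>nbrs \<A> X\<close>.
\<close>

lemma tight_Un:
  assumes "rank_of M X = card (nbrs \<A> X)" "rank_of M Y = card (nbrs \<A> Y)"
  shows "rank_of M (X \<union> Y) = card (nbrs \<A> (X \<union> Y))"
proof -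
  \<comment> \<open>A basis of a tight set \<open>Z\<close> has as many elements as \<open>Z\<close>
    has neighbours, so its matching uses all of them.\<close>
  have onto: "\<exists>J \<psi>. J \<subseteq> Z \<and> matching \<A> \<psi> J \<and> \<psi> ` J = nbrs \<A> Z"
    if "rank_of M Z = card (nbrs \<A> Z)" for Z
  proof -
    obtain J where J: "J \<subseteq> Z" "indep M J" "card J = rank_of M Z"
      using basis_extension[OF indep_empty, of Z] by blast
    then obtain \<psi> where \<psi>: "matching \<A> \<psi> J" using indep_iff_matching by blast
    have "\<psi> ` J = nbrs \<A> Z"
      using card_seteq[OF finite_nbrs matching_image_nbrs[OF \<psi> J(1)]] J that \<psi>
      by (simp add: matching_def card_image)
    with J \<psi> show ?thesis by blast
  qed
  obtain J \<psi> where J: "J \<subseteq> X" "matching \<A> \<psi> J" "\<psi> ` J = nbrs \<A> X"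
    using onto[OF assms(1)] by blast
  obtain K \<phi> where K: "K \<subseteq> Y" "matching \<A> \<phi> K" "\<phi> ` K = nbrs \<A> Y"
    using onto[OF assms(2)] by blast
  define K' where "K' = {y \<in> K. \<phi> y \<notin> nbrs \<A> X}"
  define \<chi> where "\<chi> x = (if x \<in> J then \<psi> x else \<phi> x)" for x
  have disj: "K' \<inter> X = {}"
    using K(2) by (auto simp: K'_def matching_def nbrs_def)
  have im: "\<chi> ` (J \<union> K') = nbrs \<A> (X \<union> Y)"
  proof -
    have "\<chi> ` J = \<psi> ` J" "\<chi> ` K' = \<phi> ` K'"
      using disj J(1) by (auto simp: \<chi>_def image_iff)
    moreover have "\<phi> ` K' = nbrs \<A> Y - nbrs \<A> X"
      using K(3) by (auto simp: K'_def)
    ultimately show ?thesis using J(3) by (simp add: image_Un nbrs_Un)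
  qed
  have m: "matching \<A> \<chi> (J \<union> K')"
    unfolding \<chi>_def
  proof (rule matching_disjoint_Un[OF J(2)])
    show "matching \<A> \<phi> K'"
      by (rule matching_subset[OF K(2)]) (simp add: K'_def)
    show "\<psi> ` J \<inter> \<phi> ` K' = {}"
      using J(3) by (auto simp: K'_def)
  qed
  then have c: "card (J \<union> K') = card (nbrs \<A> (X \<union> Y))"
    using card_image[of \<chi> "J \<union> K'"] im by (simp add: matching_def)
  have "card (J \<union> K') \<le> rank_of M (X \<union> Y)"
    by (rule card_le_rank) (use m indep_iff_matching J K in \<open>auto simp: K'_def\<close>)
  with c rank_le_nbrs[of "X \<union> Y"] show ?thesis by simp
qed

lemma tight_Union:
  assumes "finite T" "\<And>k. k \<in> T \<Longrightarrow> rank_of M (f k) = card (nbrs \<A> (f k))"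
  shows "rank_of M (\<Union>k\<in>T. f k) = card (nbrs \<A> (\<Union>k\<in>T. f k))"
  using assms
proof (induction T rule: finite_induct)
  case empty
  show ?case using rank_le_nbrs[of "{}"] by (auto simp: nbrs_def)
next
  case (insert k T)
  then show ?case using tight_Un[of "f k" "\<Union>k\<in>T. f k"] by simp
qed

text \<open>
  By Hall's theorem some \<open>Y \<subseteq> C\<close> has fewer neighbours than elements, and \<open>Y = C\<close>
  because the proper subsets of \<open>C\<close> are independent.
\<close>

lemma tight_circuit:
  assumes "is_circuit M C"
  shows "rank_of M C = card (nbrs \<A> C)"
proof -
  define D where "D x = {k. k < length \<A> \<and> x \<in> \<A> ! k}" for x
  have D: "(\<Union>x\<in>Y. D x) = nbrs \<A> Y" for Y
    by (auto simp: D_def nbrs_def)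
  have finC: "finite C"
    using assms finite_ground finite_subset by (auto simp: is_circuit_def)
  have "\<not> (\<exists>g. inj_on g C \<and> (\<forall>x\<in>C. g x \<in> D x))"
    using assms indep_iff_matching[of C] by (auto simp: is_circuit_def matching_def D_def)
  moreover have "finite (D x)" for x by (simp add: D_def)
  ultimately obtain Y where Y: "Y \<subseteq> C" "card (nbrs \<A> Y) < card Y"
    using hall_marriage[OF finC, of D] unfolding D by (meson not_less)
  have "Y = C"
  proof (rule ccontr)
    assume "Y \<noteq> C"
    with Y(1) assms have "indep M Y" by (auto simp: is_circuit_def)
    then show False
      using card_le_rank[of Y Y] rank_le_nbrs[of Y] Y(2) by simp
  qed
  with Y(2) rank_circuit[OF assms] rank_le_nbrs[of C] show ?thesis by simp
qed

lemma tight_cyclic: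
  assumes "is_cyclic M X"
  shows "rank_of M X = card (nbrs \<A> X)"
proof -
  obtain \<C> where \<C>: "\<And>C. C \<in> \<C> \<Longrightarrow> is_circuit M C" "X = \<Union>\<C>"
    using assms by (auto simp: is_cyclic_def)
  have "finite \<C>"
    by (rule finite_subset[of _ "Pow (ground M)"])
      (use \<C>(1) finite_ground in \<open>auto simp: is_circuit_def\<close>)
  from tight_Union[OF this, of "\<lambda>C. C"] tight_circuit \<C> show ?thesis by simp
qed

section \<open>From private elements to the rank equation\<close>

text \<open>The private elements form the basis. One belonging to an index in
  \<open>nbrs \<A> F\<close> adds no neighbour to the tight set \<open>F\<close>, so it does not
  raise the rank and lies in the flat \<open>F\<close>.\<close>

lemma fundamental_basis_of_private:
  assumes priv: "\<And>i. i < length \<A> \<Longrightarrow> \<A> ! i - (\<Union>j\<in>{..<length \<A>} - {i}. \<A> ! j) \<noteq> {}"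
  shows "\<exists>B. fundamental_basis M B"
proof -
  have "\<forall>i. \<exists>b. i < length \<A> \<longrightarrow> b \<in> \<A> ! i - (\<Union>j\<in>{..<length \<A>} - {i}. \<A> ! j)"
    using priv by blast
  then obtain b where b: "\<And>i. i < length \<A> \<Longrightarrow> b i \<in> \<A> ! i - (\<Union>j\<in>{..<length \<A>} - {i}. \<A> ! j)"
    by metis
  have mem: "b i \<in> \<A> ! i" if "i < length \<A>" for i using b[OF that] by blast
  have uniq: "i = j" if "i < length \<A>" "j < length \<A>" "b i \<in> \<A> ! j" for i j
    using b[OF that(1)] that(2,3) by blast
  have inj: "inj_on b {..<length \<A>}"
    using mem uniq by (fastforce intro: inj_onI)
  define B where "B = b ` {..<length \<A>}"
  have "matching \<A> (the_inv_into {..<length \<A>} b) B"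
    unfolding matching_def B_def
    using inj_on_the_inv_into[OF inj] the_inv_into_f_f[OF inj] mem by auto
  then have indB: "indep M B" using indep_iff_matching by blast
  moreover have "rank_of M F \<le> card (B \<inter> F)" if F: "F \<in> cyclic_flats M" for F
  proof -
    have rF: "rank_of M F = card (nbrs \<A> F)"
      using F tight_cyclic by (simp add: cyclic_flats_def)
    have "b k \<in> B \<inter> F" if k: "k \<in> nbrs \<A> F" for k
    proof -
      have kl: "k < length \<A>" using k by (simp add: nbrs_def)
      have "nbrs \<A> (insert (b k) F) = nbrs \<A> F"
        using uniq[OF kl] k by (auto simp: nbrs_def)
      then have "rank_of M (insert (b k) F) = rank_of M F"
        using rank_le_nbrs[of "insert (b k) F"] rank_mono[OF subset_insertI, of F "b k"] rF by simp
      moreover have "b k \<in> ground M"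
        using mem[OF kl] kl presentation by (auto simp: is_presentation_def set_system_on_def)
      ultimately have "b k \<in> closure_of_set M F" by (simp add: closure_of_set_def)
      then show ?thesis
        using F kl by (auto simp: B_def cyclic_flats_def is_flat_def)
    qed
    then have "b ` nbrs \<A> F \<subseteq> B \<inter> F" by blast
    moreover have "inj_on b (nbrs \<A> F)"
      by (rule inj_on_subset[OF inj]) (auto simp: nbrs_def)
    ultimately show ?thesis
      using card_mono[of "B \<inter> F" "b ` nbrs \<A> F"] indep_finite[OF indB] rF
      by (simp add: card_image)
  qed
  ultimately show ?thesis by (auto simp: fundamental_basis_def)
qed

text \<open>The common neighbours bound the rank from above. From below it is bounded by the part of
  \<open>B\<close> in the intersection, whose matching covers all common neighbours.\<close>

lemma fundamental_basis_rank_Inter: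
  assumes "fundamental_basis M B" "\<F> \<subseteq> cyclic_flats M" "\<F> \<noteq> {}"
  shows "rank_of M (\<Inter>F\<in>\<F>. F) = card (\<Inter>F\<in>\<F>. nbrs \<A> F)"
proof (rule antisym)
  obtain G where G: "G \<in> \<F>" using assms(3) by blast
  have "nbrs \<A> (\<Inter>F\<in>\<F>. F) \<subseteq> (\<Inter>F\<in>\<F>. nbrs \<A> F)"
    by (auto simp: nbrs_def)
  moreover have "finite (\<Inter>F\<in>\<F>. nbrs \<A> F)"
    by (rule finite_subset[OF INF_lower[OF G] finite_nbrs])
  ultimately have "card (nbrs \<A> (\<Inter>F\<in>\<F>. F)) \<le> card (\<Inter>F\<in>\<F>. nbrs \<A> F)"
    by (rule card_mono[rotated])
  with rank_le_nbrs show "rank_of M (\<Inter>F\<in>\<F>. F) \<le> card (\<Inter>F\<in>\<F>. nbrs \<A> F)"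
    by (rule order.trans)
  have indB: "indep M B" using assms(1) by (simp add: fundamental_basis_def)
  then obtain \<psi> where \<psi>: "matching \<A> \<psi> B" using indep_iff_matching by blast
  then have inj: "inj_on \<psi> B" by (simp add: matching_def)
  have onto: "\<psi> ` (B \<inter> F) = nbrs \<A> F" if "F \<in> \<F>" for F
  proof (rule card_seteq[OF finite_nbrs])
    show "\<psi> ` (B \<inter> F) \<subseteq> nbrs \<A> F"
      by (rule matching_image_nbrs[OF matching_subset[OF \<psi>]]) auto
    have "card (\<psi> ` (B \<inter> F)) = card (B \<inter> F)"
      by (rule card_image[OF inj_on_subset[OF inj]]) simp
    then show "card (nbrs \<A> F) \<le> card (\<psi> ` (B \<inter> F))"
      using that assms(1,2) tight_cyclic by (auto simp: fundamental_basis_def cyclic_flats_def)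
  qed
  have "(\<Inter>F\<in>\<F>. nbrs \<A> F) = \<psi> ` (\<Inter>F\<in>\<F>. B \<inter> F)"
    using image_INT[OF inj _ G, of "\<lambda>F. B \<inter> F"] onto by simp
  also have "card \<dots> = card (\<Inter>F\<in>\<F>. B \<inter> F)"
    by (rule card_image[OF inj_on_subset[OF inj]]) (use G in blast)
  also have "\<dots> \<le> rank_of M (\<Inter>F\<in>\<F>. F)"
    by (rule card_le_rank[OF indep_subset[OF indB]]) (use G in blast)+
  finally show "card (\<Inter>F\<in>\<F>. nbrs \<A> F) \<le> rank_of M (\<Inter>F\<in>\<F>. F)" .
qed

section \<open>From the rank equation on filters to a fundamental basis\<close>

text \<open>
  To an index \<open>k\<close> belongs the filter of the cyclic flats that meet \<open>\<A> ! k\<close>; its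
  intersection \<open>core k\<close> has rank \<open>card (up k)\<close>, where \<open>up\<close> is the preorder given by
  inclusion of these filters.
\<close>

lemma fundamental_basis_of_filters:
  assumes hyp: "\<And>\<F>. is_filter_in (cyclic_flats M) \<F> \<Longrightarrow> \<F> \<noteq> {} \<Longrightarrow>
    rank_of M (\<Inter>F\<in>\<F>. F) = card (\<Inter>F\<in>\<F>. nbrs \<A> F)"
  shows "\<exists>B. fundamental_basis M B"
proof -
  \<comment> \<open>Indices met by no cyclic flat are left out: for them \<open>flats k\<close> is
    empty and \<open>core k\<close> would be \<open>UNIV\<close>.\<close>
  define V where "V = (\<Union>F\<in>cyclic_flats M. nbrs \<A> F)"
  define flats where "flats k = {F \<in> cyclic_flats M. k \<in> nbrs \<A> F}" for k
  define core where "core k = (\<Inter>F\<in>flats k. F)" for k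
  \<comment> \<open>For \<open>k \<in> V\<close> this is the set counted on the right of the rank
    equation for the filter \<open>flats k\<close>.\<close>
  define up where "up k = {l \<in> V. flats k \<subseteq> flats l}" for k
  have finV: "finite V" unfolding V_def using finite_cyclic_flats by simp
  have up_eq: "(\<Inter>F\<in>flats k. nbrs \<A> F) = up k" if "k \<in> V" for k
    using that by (auto simp: up_def flats_def V_def)
  \<comment> \<open>The rank \<open>card (up k)\<close> is at most the number of neighbours of
    \<open>core k\<close>, which all lie in \<open>up k\<close>; so the two sets agree and
    \<open>core k\<close> is tight.\<close>
  have core: "rank_of M (core k) = card (nbrs \<A> (core k)) \<and> nbrs \<A> (core k) = up k"
    if k: "k \<in> V" for k
  proof -
    have "is_filter_in (cyclic_flats M) (flats k)"
      using nbrs_mono by (fastforce simp: is_filter_in_def flats_def)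
    moreover have "flats k \<noteq> {}" using k by (auto simp: flats_def V_def)
    ultimately have r: "rank_of M (core k) = card (up k)"
      using hyp up_eq[OF k] by (simp add: core_def)
    have sub: "nbrs \<A> (core k) \<subseteq> up k"
      unfolding up_eq[OF k, symmetric] core_def by (auto simp: nbrs_def)
    have "finite (up k)" using finV by (simp add: up_def)
    from card_seteq[OF this sub] r rank_le_nbrs[of "core k"]
    have "nbrs \<A> (core k) = up k" by simp
    with r show ?thesis by simp
  qed
  have "\<exists>B. indep M B \<and> B \<subseteq> (\<Union>k\<in>V. core k) \<and>
    (\<forall>W\<subseteq>V. (\<forall>k\<in>W. up k \<subseteq> W) \<longrightarrow> card W \<le> card (B \<inter> (\<Union>k\<in>W. core k)))"
  proof (rule indep_meeting_up_sets[OF finV, where U = V])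
    fix W assume W: "W \<subseteq> V" "\<forall>k\<in>W. up k \<subseteq> W"
    have "rank_of M (\<Union>k\<in>W. core k) = card (nbrs \<A> (\<Union>k\<in>W. core k))"
      by (rule tight_Union) (use W(1) finV core finite_subset in blast)+
    moreover have "nbrs \<A> (\<Union>k\<in>W. core k) = (\<Union>k\<in>W. nbrs \<A> (core k))"
      by (auto simp: nbrs_def)
    moreover have "\<dots> = (\<Union>k\<in>W. up k)" using core W(1) by blast
    moreover have "\<dots> = W" using W by (auto simp: up_def)
    ultimately show "rank_of M (\<Union>k\<in>W. core k) = card W" by simp
  qed (auto simp: up_def)
  then obtain B where indB: "indep M B"
    and B: "\<And>W. W \<subseteq> V \<Longrightarrow> \<forall>k\<in>W. up k \<subseteq> W \<Longrightarrow> card W \<le> card (B \<inter> (\<Union>k\<in>W. core k))"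
    by blast
  have "rank_of M F \<le> card (B \<inter> F)" if F: "F \<in> cyclic_flats M" for F
  proof -
    \<comment> \<open>\<open>nbrs \<A> F\<close> is closed under \<open>up\<close>, and
      \<open>F\<close> contains \<open>core k\<close> for each \<open>k\<close> in it because
      \<open>F \<in> flats k\<close>.\<close>
    have "card (nbrs \<A> F) \<le> card (B \<inter> (\<Union>k\<in>nbrs \<A> F. core k))"
      by (rule B) (use F in \<open>auto simp: V_def up_def flats_def\<close>)
    also have "\<dots> \<le> card (B \<inter> F)"
      by (rule card_mono) (use F indep_finite[OF indB] in \<open>auto simp: core_def flats_def\<close>)
    finally show ?thesis using rank_le_nbrs[of F] by simp
  qed
  with indB show ?thesis by (auto simp: fundamental_basis_def)
qed

end

section \<open>Families, filters and antichains compared\<close>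

text \<open>Passing to the minimal members of a finite family yields an antichain and changes
  neither intersection, because \<open>nbrs\<close> is monotone.\<close>

lemma antichain_imp_all_families:
  assumes fin: "finite \<Z>"
    and anti: "\<And>\<G>. is_antichain_in \<Z> \<G> \<Longrightarrow> \<G> \<noteq> {} \<Longrightarrow> rank_of M (\<Inter>F\<in>\<G>. F) = card (\<Inter>F\<in>\<G>. nbrs \<A> F)"
    and \<F>: "\<F> \<subseteq> \<Z>" "\<F> \<noteq> {}"
  shows "rank_of M (\<Inter>F\<in>\<F>. F) = card (\<Inter>F\<in>\<F>. nbrs \<A> F)"
proof -
  define \<G> where "\<G> = {F \<in> \<F>. \<forall>G\<in>\<F>. G \<subseteq> F \<longrightarrow> G = F}"
  have finF: "finite \<F>" using fin \<F>(1) finite_subset by blast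
  have below: "\<exists>G\<in>\<G>. G \<subseteq> F" if "F \<in> \<F>" for F
    using finite_has_minimal2[OF finF that] unfolding \<G>_def by blast
  have "\<G> \<noteq> {}" using \<F>(2) below by blast
  moreover have "is_antichain_in \<Z> \<G>"
    using \<F>(1) by (auto simp: is_antichain_in_def \<G>_def)
  ultimately have "rank_of M (\<Inter>F\<in>\<G>. F) = card (\<Inter>F\<in>\<G>. nbrs \<A> F)"
    using anti by blast
  moreover have "(\<Inter>F\<in>\<G>. F) = (\<Inter>F\<in>\<F>. F)"
    using below by (fastforce simp: \<G>_def)
  moreover have "(\<Inter>F\<in>\<G>. nbrs \<A> F) = (\<Inter>F\<in>\<F>. nbrs \<A> F)"
  proof
    show "(\<Inter>F\<in>\<G>. nbrs \<A> F) \<subseteq> (\<Inter>F\<in>\<F>. nbrs \<A> F)"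
      using below nbrs_mono by (meson INF_greatest INF_lower2)
  qed (auto simp: \<G>_def)
  ultimately show ?thesis by simp
qed

theorem corollary4p6:
  fixes M :: "'a indep_structure"
    and \<A> :: "'a set list"
    and v :: "nat \<Rightarrow> 'v"
  assumes "transversal_matroid M"
    and "is_presentation M \<A>"
    and "inj_on v {..<length \<A>}"
  shows "(fundamental_transversal_matroid M \<longleftrightarrow>
      (\<forall>\<F>. \<F> \<subseteq> cyclic_flats M \<and> \<F> \<noteq> {} \<longrightarrow>
        rank_of M (\<Inter>F\<in>\<F>. F) = card (\<Inter>F\<in>\<F>. Delta v \<A> F))) \<and>
    (fundamental_transversal_matroid M \<longleftrightarrow>
      (\<forall>\<F>. is_filter_in (cyclic_flats M) \<F> \<and> \<F> \<noteq> {} \<longrightarrow>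
        rank_of M (\<Inter>F\<in>\<F>. F) = card (\<Inter>F\<in>\<F>. Delta v \<A> F))) \<and>
    (fundamental_transversal_matroid M \<longleftrightarrow>
      (\<forall>\<F>. is_antichain_in (cyclic_flats M) \<F> \<and> \<F> \<noteq> {} \<longrightarrow>
        rank_of M (\<Inter>F\<in>\<F>. F) = card (\<Inter>F\<in>\<F>. Delta v \<A> F)))"
proof -
  have mat: "matroid M" using assms(1) by (simp add: transversal_matroid_def)
  interpret presented_matroid M \<A>
    using mat assms(2) by (simp add: presented_matroid_def presented_matroid_axioms_def)
  let ?P = "\<lambda>\<F>. rank_of M (\<Inter>F\<in>\<F>. F) = card (\<Inter>F\<in>\<F>. nbrs \<A> F)"
  note Delta = card_Inter_Delta[OF assms(3)]
  have fund_all: "?P \<F>"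
    if fund: "fundamental_transversal_matroid M" and \<F>: "\<F> \<subseteq> cyclic_flats M" "\<F> \<noteq> {}" for \<F>
  proof -
    obtain \<B> where \<B>: "is_presentation M \<B>"
      "\<forall>i<length \<B>. \<B> ! i - (\<Union>j\<in>{..<length \<B>} - {i}. \<B> ! j) \<noteq> {}"
      using fund unfolding fundamental_transversal_matroid_def by blast
    \<comment> \<open>The basis comes from the private elements of \<open>\<B>\<close> but concerns
      \<open>M\<close> alone, so it gives the rank equation for \<open>\<A>\<close>.\<close>
    interpret \<B>: presented_matroid M \<B>
      using mat \<B>(1) by (simp add: presented_matroid_def presented_matroid_axioms_def)
    obtain B where "fundamental_basis M B"
      using \<B>.fundamental_basis_of_private \<B>(2) by blast
    from fundamental_basis_rank_Inter[OF this \<F>] show ?thesis .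
  qed
  \<comment> \<open>Filters are families, and antichains control all families, so the way back from
    filters serves all three equivalences.\<close>
  have filter_fund: "fundamental_transversal_matroid M"
    if "\<And>\<F>. is_filter_in (cyclic_flats M) \<F> \<Longrightarrow> \<F> \<noteq> {} \<Longrightarrow> ?P \<F>"
    using fundamental_basis_of_filters[OF that] fundamental_transversal_if_fundamental_basis by blast
  have filter_sub: "\<F> \<subseteq> cyclic_flats M" if "is_filter_in (cyclic_flats M) \<F>" for \<F>
    using that by (simp add: is_filter_in_def)
  have anti_sub: "\<F> \<subseteq> cyclic_flats M" if "is_antichain_in (cyclic_flats M) \<F>" for \<F>
    using that by (simp add: is_antichain_in_def)
  show ?thesis
  proof (intro conjI iffI allI impI; (elim conjE)?)
    assume *: "\<forall>\<F>. \<F> \<subseteq> cyclic_flats M \<and> \<F> \<noteq> {} \<longrightarrow>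
        rank_of M (\<Inter>F\<in>\<F>. F) = card (\<Inter>F\<in>\<F>. Delta v \<A> F)"
    show "fundamental_transversal_matroid M"
    proof (rule filter_fund)
      fix \<F> assume "is_filter_in (cyclic_flats M) \<F>" "\<F> \<noteq> {}"
      with * show "?P \<F>" by (simp add: filter_sub Delta)
    qed
  next
    assume *: "\<forall>\<F>. is_filter_in (cyclic_flats M) \<F> \<and> \<F> \<noteq> {} \<longrightarrow>
        rank_of M (\<Inter>F\<in>\<F>. F) = card (\<Inter>F\<in>\<F>. Delta v \<A> F)"
    show "fundamental_transversal_matroid M"
    proof (rule filter_fund)
      fix \<F> assume "is_filter_in (cyclic_flats M) \<F>" "\<F> \<noteq> {}"
      with * show "?P \<F>" by (simp add: Delta)
    qed
  next
    assume *: "\<forall>\<F>. is_antichain_in (cyclic_flats M) \<F> \<and> \<F> \<noteq> {} \<longrightarrow>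
        rank_of M (\<Inter>F\<in>\<F>. F) = card (\<Inter>F\<in>\<F>. Delta v \<A> F)"
    have anti: "?P \<G>" if "is_antichain_in (cyclic_flats M) \<G>" "\<G> \<noteq> {}" for \<G>
      using * that by (simp add: Delta)
    show "fundamental_transversal_matroid M"
    proof (rule filter_fund)
      fix \<F> assume "is_filter_in (cyclic_flats M) \<F>" "\<F> \<noteq> {}"
      then show "?P \<F>"
        using antichain_imp_all_families[OF finite_cyclic_flats anti filter_sub] by blast
    qed
  qed (use fund_all filter_sub anti_sub in \<open>simp_all add: Delta\<close>)
qed

end
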